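(* Let $p(z)=p_0(z^2)+zp_1(z^2)$ be a real polynomial, where $p_0$ and $p_1$ are real polynomials. Then $p$ is self-interlacing of type I if and only if the polynomial $q(z)=p_0(-z^2)-zp_1(-z^2)$ is Hurwitz stable.
   Context: A real polynomial $p$ of degree $n$ is self-interlacing of type I if all its zeroes $\lambda_1,\dots,\lambda_n$ are real and simple and, suitably numbered, satisfy $0<\lambda_1<-\lambda_2<\lambda_3<\dots<(-1)^{n-1}\lambda_n$. A polynomial is Hurwitz stable if all its zeroes lie in the open left half-plane $\{z\in\mathbb{C}:\operatorname{Re}z<0\}$. *)

theory Defs
  imports Complex_Main "HOL-Computational_Algebra.Computational_Algebra"
begin

abbreviation complex_poly :: "real poly \<Rightarrow> complex poly" where
  "complex_poly p \<equiv> map_poly complex_of_real p"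

text \<open>
  Zeroes are taken in the complex plane. Nonzero constants satisfy both predicates below vacuously;
  the zero polynomial, which vanishes everywhere, satisfies neither.
\<close>

definition hurwitz_stable :: "real poly \<Rightarrow> bool" where
  "hurwitz_stable p \<longleftrightarrow> (\<forall>z::complex. poly (complex_poly p) z = 0 \<longrightarrow> Re z < 0)"

text \<open>
  The numbering is \<open>r 1, \<dots>, r n\<close> with \<open>n = degree p\<close>. The last two conjuncts are the chain
  \<open>0 < r 1 < - r 2 < r 3 < \<dots> < (-1)^(n-1) * r n\<close>; the exponent \<open>i + 1\<close> has the parity of \<open>i - 1\<close>.
\<close>

definition self_interlacing_I :: "real poly \<Rightarrow> bool" where
  "self_interlacing_I p \<longleftrightarrow>
     (\<forall>z::complex. poly (complex_poly p) z = 0 \<longrightarrow> z \<in> \<real> \<and> order z (complex_poly p) = 1) \<and>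
     (\<exists>r :: nat \<Rightarrow> real.
        bij_betw r {1..degree p} {x. poly p x = 0} \<and>
        (1 \<le> degree p \<longrightarrow> 0 < r 1) \<and>
        (\<forall>i. 1 \<le> i \<and> i < degree p \<longrightarrow> (-1) ^ (i + 1) * r i < (-1) ^ (i + 2) * r (i + 1)))"

end

theory Submission
  imports Defs
begin

text \<open>
Write \<open>p(z) = E(z) + O(z)\<close> with \<open>E(z) = p0(z\<^sup>2)\<close> even and \<open>O(z) = z p1(z\<^sup>2)\<close> odd. Then
\<open>q(\<i>z) = E(z) - \<i> O(z)\<close>, that is,
\<open>2 q(\<i>z) = (1 - \<i>) p(z) + (1 + \<i>) p(-z)\<close>.
The zeroes of \<open>q\<close> are thus the points \<open>\<i>z\<close> with \<open>p(-z) / p(z) = \<i>\<close>, provided that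
\<open>p(z)\<close> and \<open>p(-z)\<close> do not vanish together. So \<open>q\<close> is stable when \<open>\<Phi>(z) = p(-z) / p(z)\<close> takes
the value \<open>\<i>\<close> only in the upper half-plane. Both properties in the theorem are
equivalent to a third one:

\<^item> all zeroes of \<open>p\<close> are real, and \<open>p'(x) p(-x) < 0\<close> at each of them,

which says that \<open>\<Phi>\<close> is a real constant plus a sum of simple fractions \<open>t / (z - x)\<close> with
real \<open>x\<close> and \<open>t < 0\<close>.

From the third property to stability: every such fraction has an imaginary part of the sign of
\<open>Im z\<close>, so \<open>\<Phi>(z) = \<i>\<close> forces \<open>Im z > 0\<close> (\<open>residues_imp_stable_rotation\<close>).

From stability to the third property (\<open>stable_rotation_imp_residues\<close>): each factor of a stable
polynomial \<open>Q\<close> is larger at \<open>w\<close> than at the mirror image \<open>- cnj w\<close> when \<open>Re w > 0\<close>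
(\<open>stable_reflection_less\<close>), while a zero \<open>z\<close> of \<open>p\<close> gives \<open>|q(\<i>z)| = |q(-\<i>z)|\<close>; hence \<open>z\<close> is
real. Moreover the argument of \<open>Q\<close> increases strictly along the imaginary axis
(\<open>stable_phase_increasing\<close>), and at a zero of \<open>p\<close> this inequality reads \<open>p'(x) p(-x) < 0\<close>.

Self-interlacing and the third property (\<open>self_interlacing_I_iff_residues\<close>): if \<open>R\<close> is the set of
the \<open>n\<close> simple real zeroes, then \<open>p'(a) p(-a)\<close> is a positive multiple of
\<open>(-1)^n a (\<Prod>b\<in>R - {a}. a\<^sup>2 - b\<^sup>2)\<close>. If this is nonzero for all \<open>a\<close>, the zeroes have distinct
absolute values; number them by increasing absolute value. The product then has the sign
\<open>(-1)^(n - j)\<close> at the \<open>j\<close>-th zero \<open>a\<close>, so the expression is negative exactly when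
\<open>a\<close> has the sign \<open>(-1)^(j + 1)\<close>.
\<close>

section \<open>Real polynomials as complex polynomials\<close>

lemma poly_complex_poly_of_real: "poly (complex_poly p) (of_real x) = of_real (poly p x)"
  by (induction p) (simp_all add: map_poly_pCons)

lemma complex_poly_add: "complex_poly (f + g) = complex_poly f + complex_poly g"
  by (rule poly_eqI) (simp add: coeff_map_poly)

lemma complex_poly_diff: "complex_poly (f - g) = complex_poly f - complex_poly g"
  by (rule poly_eqI) (simp add: coeff_map_poly)

lemma complex_poly_mult: "complex_poly (f * g) = complex_poly f * complex_poly g"
  by (rule poly_eqI) (simp add: coeff_map_poly coeff_mult)

lemma poly_complex_poly_pcompose:
  "poly (complex_poly (pcompose p r)) z = poly (complex_poly p) (poly (complex_poly r) z)"
  by (induction p)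
     (simp_all add: pcompose_pCons complex_poly_add complex_poly_mult map_poly_pCons)

lemma pderiv_complex_poly: "pderiv (complex_poly p) = complex_poly (pderiv p)"
  by (rule poly_eqI) (simp add: coeff_pderiv coeff_map_poly)

section \<open>Partial fractions with simple poles\<close>

lemma poly_pderiv_prod_linear:
  fixes c :: "'a :: idom"
  assumes "finite A" "a \<in> A"
  shows "poly (pderiv (smult c (\<Prod>b\<in>A. [:-b, 1:]))) a = c * (\<Prod>b\<in>A - {a}. a - b)"
proof -
  have "(\<Sum>x\<in>A. \<Prod>b\<in>A - {x}. a - b) = (\<Sum>x\<in>A. if x = a then \<Prod>b\<in>A - {a}. a - b else 0)"
    using assms by (intro sum.cong) auto
  also have "\<dots> = (\<Prod>b\<in>A - {a}. a - b)"
    using assms by simp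
  finally show ?thesis
    by (simp add: pderiv_smult pderiv_prod pderiv_pCons poly_sum poly_prod)
qed

text \<open>
Lagrange interpolation at the zeroes of \<open>P\<close>. A numerator of the same degree as \<open>P\<close> is allowed: \<open>G\<close>
and the interpolating polynomial \<open>H\<close> agree at all \<open>degree P\<close> zeroes and also in the coefficient
of that degree, which determines a polynomial of degree at most \<open>degree P\<close>.
\<close>

lemma partial_fractions_simple_zeroes:
  fixes P G :: "complex poly"
  assumes sf: "rsquarefree P" and deg: "degree G \<le> degree P" and z: "poly P z \<noteq> 0"
  shows "poly G z / poly P z = coeff G (degree P) / lead_coeff P +
           (\<Sum>a | poly P a = 0. poly G a / poly (pderiv P) a / (z - a))"
proof -
  define A c where "A = {a. poly P a = 0}" and "c = lead_coeff P"
  define L where "L = (\<lambda>a. \<Prod>b\<in>A - {a}. [:-b, 1:])"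
  define k where "k = coeff G (degree P) / c"
  define w where "w = (\<lambda>a. poly G a / poly (pderiv P) a * c)"
  define H where "H = smult k P + (\<Sum>a\<in>A. smult (w a) (L a))"
  have P0: "P \<noteq> 0" using z by auto
  have fin: "finite A" unfolding A_def by (rule poly_roots_finite[OF P0])
  have c0: "c \<noteq> 0" using P0 by (simp add: c_def)
  have P: "P = smult c (\<Prod>b\<in>A. [:-b, 1:])"
    unfolding A_def c_def using complex_poly_decompose_rsquarefree[OF sf] by simp
  have degP: "degree P = card A"
    by (subst P) (use c0 in \<open>simp add: degree_prod_sum_eq\<close>)
  have degL: "degree (L a) < card A" if "a \<in> A" for a
    using that fin card_gt_0_iff[of A] by (auto simp: L_def degree_prod_sum_eq)
  have dP: "poly (pderiv P) a = c * (\<Prod>b\<in>A - {a}. a - b)" if "a \<in> A" for a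
    by (subst P) (rule poly_pderiv_prod_linear[OF fin that])
  have dP0: "poly (pderiv P) a \<noteq> 0" if "a \<in> A" for a
    using dP[OF that] c0 fin by simp
  have GH: "G = H"
  proof (rule poly_eqI_degree_lead_coeff)
    show "coeff G (card A) = coeff H (card A)"
      using degL c0 by (simp add: H_def coeff_sum coeff_eq_0 k_def flip: degP c_def)
    show "degree G \<le> card A" using deg degP by simp
    show "degree H \<le> card A"
      unfolding H_def using degL degP
      by (intro degree_add_le degree_sum_le fin) (auto intro: order.trans[OF degree_smult_le] less_imp_le)
    fix x assume x: "x \<in> A"
    have "(\<Sum>a\<in>A. poly (smult (w a) (L a)) x) = (\<Sum>a\<in>A. if a = x then poly G x else 0)"
    proof (rule sum.cong)
      fix a assume a: "a \<in> A"
      show "poly (smult (w a) (L a)) x = (if a = x then poly G x else 0)"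
      proof (cases "a = x")
        case True
        then show ?thesis
          using dP[OF x] dP0[OF x] by (simp add: w_def L_def poly_prod)
      next
        case False
        then show ?thesis
          using x fin by (auto simp: L_def poly_prod)
      qed
    qed simp
    then show "poly G x = poly H x"
      using x fin by (simp add: H_def poly_sum A_def)
  qed simp
  have "poly (L a) z = poly P z / (c * (z - a))" if "a \<in> A" for a
  proof -
    have "poly P z = c * (\<Prod>b\<in>A. z - b)"
      by (subst P) (simp add: poly_prod)
    then have "poly P z = c * ((z - a) * (\<Prod>b\<in>A - {a}. z - b))"
      by (simp only: prod.remove[OF fin that])
    then show ?thesis
      using z c0 by (auto simp: L_def poly_prod)
  qed
  then have "poly G z = k * poly P z + (\<Sum>a\<in>A. w a * (poly P z / (c * (z - a))))"
    by (subst GH) (simp add: H_def poly_sum)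
  then have "poly G z / poly P z = k + (\<Sum>a\<in>A. w a * (poly P z / (c * (z - a)))) / poly P z"
    using z by (simp add: add_divide_distrib)
  also have "\<dots> = k + (\<Sum>a\<in>A. poly G a / poly (pderiv P) a / (z - a))"
    using z c0 by (simp add: sum_divide_distrib w_def)
  finally show ?thesis
    by (simp add: k_def A_def c_def)
qed

section \<open>Two inequalities for stable polynomials\<close>

text \<open>
The point \<open>w\<close> in the right half-plane is farther from any \<open>\<mu>\<close> in the left half-plane than its
mirror image in the imaginary axis is:
\<open>|w - \<mu>|\<^sup>2 - |- cnj w - \<mu>|\<^sup>2 = - 4 Re w Re \<mu>\<close>.
\<close>

lemma prod_linear_reflection_less:
  assumes "\<And>\<mu>. \<mu> \<in># A \<Longrightarrow> Re \<mu> < 0" "Re w > 0" "A \<noteq> {#}"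
  shows "norm (\<Prod>\<mu>\<in>#A. - cnj w - \<mu>) < norm (\<Prod>\<mu>\<in>#A. w - \<mu>)"
  using assms(1,3)
proof (induction A)
  case (add \<mu> A)
  have \<mu>: "Re \<mu> < 0" using add.prems by simp
  have "Re w * Re \<mu> < 0" using \<mu> assms(2) by (simp add: mult_pos_neg)
  then have "(norm (- cnj w - \<mu>))\<^sup>2 < (norm (w - \<mu>))\<^sup>2"
    unfolding cmod_power2 by (simp add: power2_eq_square algebra_simps)
  then have lt: "norm (- cnj w - \<mu>) < norm (w - \<mu>)"
    by (rule power2_less_imp_less) simp
  show ?case
  proof (cases "A = {#}")
    case False
    then have "norm (\<Prod>\<mu>\<in>#A. - cnj w - \<mu>) < norm (\<Prod>\<mu>\<in>#A. w - \<mu>)"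
      using add by simp
    with lt show ?thesis
      by (simp add: norm_mult mult_strict_mono')
  qed (use lt in simp)
qed simp

lemma poly_prod_linear_mset: "poly (\<Prod>x\<in>#A. [:-x, 1:]) z = (\<Prod>x\<in>#A. z - x)"
  for z :: "'a :: comm_ring_1"
  by (induction A) (simp_all add: algebra_simps)

lemma proots_nonempty:
  fixes Q :: "complex poly"
  assumes "degree Q > 0"
  shows "proots Q \<noteq> {#}"
  using assms complex_poly_decompose_multiset[of Q]
  by (metis degree_smult_eq degree_1 image_mset_empty less_irrefl_nat prod_mset_empty)

lemma stable_reflection_less:
  fixes Q :: "complex poly"
  assumes "\<And>z. poly Q z = 0 \<Longrightarrow> Re z < 0" "Re w > 0" "degree Q > 0"
  shows "norm (poly Q (- cnj w)) < norm (poly Q w)"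
proof -
  have Q0: "Q \<noteq> 0" using assms(3) by auto
  have ev: "poly Q z = lead_coeff Q * (\<Prod>\<mu>\<in>#proots Q. z - \<mu>)" for z
    by (subst (1) complex_poly_decompose_multiset[symmetric]) (simp add: poly_prod_linear_mset)
  have "proots Q \<noteq> {#}"
    using assms(3) by (rule proots_nonempty)
  then show ?thesis
    using prod_linear_reflection_less[of "proots Q" w] assms Q0
    by (simp add: ev[of w] ev[of "- cnj w"] norm_mult)
qed

text \<open>
At \<open>w = \<i>y\<close> the real part of \<open>F'(w) / F(w)\<close> is the derivative with respect to \<open>y\<close> of the argument of
\<open>F(\<i>y)\<close>. It is a sum of terms \<open>Re (1 / (w - \<mu>))\<close>, all of them positive when the zeroes lie in the left
half-plane. Multiplying by \<open>|F(w)|\<^sup>2\<close> removes the quotients, and the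
induction adds one zero at a time.
\<close>

lemma prod_linear_phase_increasing:
  assumes "\<And>\<mu>. \<mu> \<in># A \<Longrightarrow> Re \<mu> < 0" "Re w = 0" "A \<noteq> {#}"
  defines "F \<equiv> (\<lambda>B. \<Prod>x\<in>#B. [:-x, 1:])"
  shows "Re (poly (pderiv (F A)) w * cnj (poly (F A) w)) > 0"
  using assms(1,3)
proof (induction A)
  case (add \<mu> A)
  define d g g' where "d = w - \<mu>" and "g = poly (F A) w" and "g' = poly (pderiv (F A)) w"
  have d: "Re d > 0" using add.prems assms(2) by (simp add: d_def)
  have F_add: "F (add_mset \<mu> A) = [:-\<mu>, 1:] * F A"
    by (simp add: F_def)
  have val: "poly (F (add_mset \<mu> A)) w = d * g"
    unfolding F_add poly_mult by (simp add: d_def g_def)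
  have der: "poly (pderiv (F (add_mset \<mu> A))) w = d * g' + g"
    unfolding F_add pderiv_mult poly_add poly_mult by (simp add: d_def g_def g'_def pderiv_pCons)
  have "(d * g' + g) * cnj (d * g) = (d * cnj d) * (g' * cnj g) + cnj d * (g * cnj g)"
    by (simp add: algebra_simps)
  then have eq: "Re ((d * g' + g) * cnj (d * g))
      = (norm d)\<^sup>2 * Re (g' * cnj g) + Re d * (norm g)\<^sup>2"
    by (simp add: complex_norm_square[symmetric] Re_complex_of_real del: of_real_power)
  have "d \<noteq> 0" using d by auto
  have "g \<noteq> 0"
    using add.prems assms(2) by (force simp: g_def F_def poly_prod_linear_mset)
  then have pos: "Re d * (norm g)\<^sup>2 > 0" using d by simp
  have "Re (g' * cnj g) \<ge> 0"
  proof (cases "A = {#}")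
    case False
    then show ?thesis using add by (simp add: g_def g'_def less_imp_le)
  qed (simp add: g'_def F_def)
  then have "(norm d)\<^sup>2 * Re (g' * cnj g) \<ge> 0" by simp
  with pos show ?case
    unfolding val der eq by linarith
qed simp

lemma stable_phase_increasing:
  fixes Q :: "complex poly"
  assumes "\<And>z. poly Q z = 0 \<Longrightarrow> Re z < 0" "Re w = 0" "degree Q > 0"
  shows "Re (poly (pderiv Q) w * cnj (poly Q w)) > 0"
proof -
  define F where "F = (\<Prod>\<mu>\<in>#proots Q. [:-\<mu>, 1:])"
  define c where "c = lead_coeff Q"
  have Q0: "Q \<noteq> 0" using assms(3) by auto
  have Q: "Q = smult c F"
    by (simp add: F_def c_def complex_poly_decompose_multiset)
  have "proots Q \<noteq> {#}"
    using assms(3) by (rule proots_nonempty)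
  then have pos: "Re (poly (pderiv F) w * cnj (poly F w)) > 0"
    unfolding F_def using assms Q0 by (intro prod_linear_phase_increasing) auto
  have "poly (pderiv Q) w * cnj (poly Q w) = (c * cnj c) * (poly (pderiv F) w * cnj (poly F w))"
    by (simp add: Q pderiv_smult algebra_simps)
  then have "Re (poly (pderiv Q) w * cnj (poly Q w)) = (norm c)\<^sup>2 * Re (poly (pderiv F) w * cnj (poly F w))"
    by (simp add: complex_norm_square[symmetric] del: of_real_power)
  moreover have "c \<noteq> 0" using Q0 by (simp add: c_def)
  ultimately show ?thesis using pos by simp
qed


section \<open>Polynomials with simple real zeroes\<close>

lemma real_zeroes_image:
  assumes real: "\<forall>z. poly (complex_poly p) z = 0 \<longrightarrow> z \<in> \<real>"
  shows "{z. poly (complex_poly p) z = 0} = complex_of_real ` {x. poly p x = 0}"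
proof safe
  fix z assume z: "poly (complex_poly p) z = 0"
  then obtain x where "z = of_real x" using real Reals_cases by metis
  with z show "z \<in> complex_of_real ` {x. poly p x = 0}"
    by (simp add: poly_complex_poly_of_real)
qed (simp add: poly_complex_poly_of_real)

lemma simple_real_zeroes_factorization:
  assumes real: "\<forall>z. poly (complex_poly p) z = 0 \<longrightarrow> z \<in> \<real>"
    and sf: "rsquarefree (complex_poly p)"
  shows "p = smult (lead_coeff p) (\<Prod>a | poly p a = 0. [:-a, 1:])"
    and "degree p = card {x. poly p x = 0}"
proof -
  define R c where "R = {x. poly p x = 0}" and "c = lead_coeff p"
  have zs: "{z. poly (complex_poly p) z = 0} = complex_of_real ` R"
    unfolding R_def using real by (rule real_zeroes_image)
  have "complex_poly p = smult (of_real c) (\<Prod>z\<in>complex_of_real ` R. [:-z, 1:])"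
    using complex_poly_decompose_rsquarefree[OF sf]
    by (simp add: zs c_def coeff_map_poly degree_map_poly)
  also have "(\<Prod>z\<in>complex_of_real ` R. [:-z, 1:]) = (\<Prod>a\<in>R. [:-of_real a, 1:])"
    by (simp add: prod.reindex inj_on_def)
  finally have P: "complex_poly p = smult (of_real c) (\<Prod>a\<in>R. [:-of_real a, 1:])" .
  have "complex_of_real (poly p x) = of_real (poly (smult c (\<Prod>a\<in>R. [:-a, 1:])) x)" for x
    unfolding poly_complex_poly_of_real[of p, symmetric] P by (simp add: poly_prod)
  then have p: "p = smult c (\<Prod>a\<in>R. [:-a, 1:])"
    by (intro poly_ext) (simp only: of_real_eq_iff)
  have "p \<noteq> 0" using sf by (auto simp: rsquarefree_def)
  then have "c \<noteq> 0" by (simp add: c_def)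
  then have "degree p = card R"
    by (subst p) (simp add: degree_prod_sum_eq)
  with p show "p = smult (lead_coeff p) (\<Prod>a | poly p a = 0. [:-a, 1:])"
    and "degree p = card {x. poly p x = 0}"
    by (simp_all add: R_def c_def)
qed

text \<open>
The factor of \<open>p'(a)\<close> that belongs to a zero \<open>b\<close> is \<open>a - b\<close>, and that of \<open>p(-a)\<close> is \<open>-(a + b)\<close>; together
they make \<open>b\<^sup>2 - a\<^sup>2\<close>. The factor \<open>-2a\<close> of \<open>p(-a)\<close> that belongs to \<open>a\<close> itself has no partner in
\<open>p'(a)\<close>.
\<close>

lemma pderiv_times_reflection_at_zero:
  fixes c :: real
  assumes fin: "finite R" and a: "a \<in> R"
  defines "p \<equiv> smult c (\<Prod>b\<in>R. [:-b, 1:])"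
  shows "poly (pderiv p) a * poly p (- a) =
           2 * c\<^sup>2 * ((-1) ^ card R * a * (\<Prod>b\<in>R - {a}. a\<^sup>2 - b\<^sup>2))"
proof -
  have "poly p (- a) = c * (\<Prod>b\<in>R. (-1) * (a + b))"
    by (simp add: p_def poly_prod algebra_simps)
  also have "\<dots> = c * ((-1) ^ card R * (2 * a * (\<Prod>b\<in>R - {a}. a + b)))"
    by (simp only: prod.distrib prod_constant prod.remove[OF fin a, of "\<lambda>b. a + b"] mult_2)
  finally have val: "poly p (- a) = c * ((-1) ^ card R * (2 * a * (\<Prod>b\<in>R - {a}. a + b)))" .
  have der: "poly (pderiv p) a = c * (\<Prod>b\<in>R - {a}. a - b)"
    unfolding p_def by (rule poly_pderiv_prod_linear[OF fin a])
  have "poly (pderiv p) a * poly p (- a) =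
      2 * c\<^sup>2 * ((-1) ^ card R * a * ((\<Prod>b\<in>R - {a}. a - b) * (\<Prod>b\<in>R - {a}. a + b)))"
    unfolding val der by (simp add: power2_eq_square)
  also have "(\<Prod>b\<in>R - {a}. a - b) * (\<Prod>b\<in>R - {a}. a + b) = (\<Prod>b\<in>R - {a}. a\<^sup>2 - b\<^sup>2)"
    by (simp add: prod.distrib[symmetric] power2_eq_square algebra_simps)
  finally show ?thesis .
qed

section \<open>Alternating numberings by absolute value\<close>

text \<open>
In the product the factors with \<open>k < j\<close> are positive and the \<open>n - j\<close> factors with \<open>k > j\<close> are
negative. Together with \<open>(-1)^n\<close> this leaves the sign \<open>(-1)^j\<close> in front of \<open>r j\<close>.
\<close>

lemma sign_prod_diff_squares:
  fixes r :: "nat \<Rightarrow> real"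
  assumes mono: "\<And>i k. 1 \<le> i \<Longrightarrow> i < k \<Longrightarrow> k \<le> n \<Longrightarrow> \<bar>r i\<bar> < \<bar>r k\<bar>"
    and j: "j \<in> {1..n}"
  shows "(-1) ^ n * r j * (\<Prod>k\<in>{1..n} - {j}. (r j)\<^sup>2 - (r k)\<^sup>2) < 0 \<longleftrightarrow> 0 < (-1) ^ (j + 1) * r j"
proof -
  have sq: "(r i)\<^sup>2 < (r k)\<^sup>2" if "1 \<le> i" "i < k" "k \<le> n" for i k
    using power_strict_mono[OF mono[OF that], of 2] by simp
  define D where "D = (\<Prod>k\<in>{1..<j}. (r j)\<^sup>2 - (r k)\<^sup>2) * (\<Prod>k\<in>{j<..n}. (r k)\<^sup>2 - (r j)\<^sup>2)"
  have D: "D > 0"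
    unfolding D_def using j by (intro mult_pos_pos prod_pos) (auto intro: sq)
  have "(\<Prod>k\<in>{j<..n}. (r j)\<^sup>2 - (r k)\<^sup>2) = (\<Prod>k\<in>{j<..n}. (-1) * ((r k)\<^sup>2 - (r j)\<^sup>2))"
    by simp
  also have "\<dots> = (-1) ^ (n - j) * (\<Prod>k\<in>{j<..n}. (r k)\<^sup>2 - (r j)\<^sup>2)"
    by (simp only: prod.distrib prod_constant card_greaterThanAtMost)
  finally have upper: "(\<Prod>k\<in>{j<..n}. (r j)\<^sup>2 - (r k)\<^sup>2) =
      (-1) ^ (n - j) * (\<Prod>k\<in>{j<..n}. (r k)\<^sup>2 - (r j)\<^sup>2)" .
  have split: "{1..n} - {j} = {1..<j} \<union> {j<..n}" using j by auto
  have "(\<Prod>k\<in>{1..n} - {j}. (r j)\<^sup>2 - (r k)\<^sup>2) =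
      (\<Prod>k\<in>{1..<j}. (r j)\<^sup>2 - (r k)\<^sup>2) * (\<Prod>k\<in>{j<..n}. (r j)\<^sup>2 - (r k)\<^sup>2)"
    unfolding split by (rule prod.union_disjoint) auto
  also have "\<dots> = (-1) ^ (n - j) * D"
    unfolding upper D_def by (rule mult.left_commute)
  finally have total: "(\<Prod>k\<in>{1..n} - {j}. (r j)\<^sup>2 - (r k)\<^sup>2) = (-1) ^ (n - j) * D" .
  have "(-1) ^ n * r j * (\<Prod>k\<in>{1..n} - {j}. (r j)\<^sup>2 - (r k)\<^sup>2) =
      ((-1) ^ n * (-1) ^ (n - j)) * (r j * D)"
    unfolding total by (simp only: mult_ac)
  also have "(-1 :: real) ^ n * (-1) ^ (n - j) = (-1) ^ j"
  proof -
    have "(-1 :: real) ^ n * (-1) ^ (n - j) = (-1) ^ (n + (n - j))"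
      by (rule power_add[symmetric])
    also have "n + (n - j) = j + 2 * (n - j)"
      using j unfolding atLeastAtMost_iff by linarith
    also have "(-1 :: real) ^ (j + 2 * (n - j)) = (-1) ^ j"
      by (simp add: power_add power_mult)
    finally show ?thesis .
  qed
  also have "(-1) ^ j * (r j * D) = - ((-1) ^ (j + 1) * r j * D)"
    by simp
  finally show ?thesis
    using mult_less_cancel_right_pos[OF D, of 0 "(-1) ^ (j + 1) * r j"]
    by (simp only: neg_less_0_iff_less mult_zero_left)
qed

text \<open>
A chain as in the definition of self-interlacing makes \<open>|r i|\<close> increase, so it can only be the
numbering by absolute value. Conversely, the sign condition makes the products nonzero; hence
absolute values are distinct on \<open>R\<close>, the numbering by absolute value exists, and
the sign lemma shows that its signs alternate.
\<close>

lemma alternating_numbering_iff: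
  fixes R :: "real set"
  assumes fin: "finite R"
  defines "n \<equiv> card R"
  shows "(\<exists>r. bij_betw r {1..n} R \<and> (1 \<le> n \<longrightarrow> 0 < r 1) \<and>
            (\<forall>i. 1 \<le> i \<and> i < n \<longrightarrow> (-1) ^ (i + 1) * r i < (-1) ^ (i + 2) * r (i + 1)))
     \<longleftrightarrow> (\<forall>a\<in>R. (-1) ^ n * a * (\<Prod>b\<in>R - {a}. a\<^sup>2 - b\<^sup>2) < 0)" (is "?L \<longleftrightarrow> ?S")
proof -
  have reindex: "(\<Prod>b\<in>R - {r j}. (r j)\<^sup>2 - b\<^sup>2) = (\<Prod>k\<in>{1..n} - {j}. (r j)\<^sup>2 - (r k)\<^sup>2)"
    if bij: "bij_betw r {1..n} R" and j: "j \<in> {1..n}" for r j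
  proof -
    have inj: "inj_on r {1..n}" and im: "r ` {1..n} = R"
      using bij by (simp_all add: bij_betw_def)
    have "r ` ({1..n} - {j}) = R - {r j}"
      using inj_on_image_set_diff[OF inj, of "{1..n}" "{j}"] j by (simp add: im[symmetric])
    then have "R - {r j} = r ` ({1..n} - {j})" ..
    moreover have "inj_on r ({1..n} - {j})"
      using inj by (rule inj_on_subset) blast
    ultimately show ?thesis by (simp add: prod.reindex)
  qed
  show ?thesis
  proof
    assume ?L
    then obtain r where bij: "bij_betw r {1..n} R" and pos1: "1 \<le> n \<Longrightarrow> 0 < r 1"
      and chain: "\<And>i. 1 \<le> i \<Longrightarrow> i < n \<Longrightarrow> (-1) ^ (i + 1) * r i < (-1) ^ (i + 2) * r (i + 1)"
      by blast
    define s where "s = (\<lambda>i. (-1) ^ (i + 1) * r i)"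
    have step: "s i < s (Suc i)" if "1 \<le> i" "i < n" for i
      using chain[OF that] by (simp add: s_def)
    have mono: "s i < s k" if "1 \<le> i" "i < k" "k \<le> n" for i k
      using that(2,3)
    proof (induction k)
      case (Suc k)
      show ?case
      proof (cases "i = k")
        case True
        then show ?thesis using step[OF \<open>1 \<le> i\<close>] Suc.prems by simp
      next
        case False
        then have "s i < s k" using Suc by simp
        also have "s k < s (Suc k)" using Suc.prems \<open>1 \<le> i\<close> by (intro step) auto
        finally show ?thesis .
      qed
    qed simp
    have pos: "0 < s i" if "1 \<le> i" "i \<le> n" for i
    proof (cases "i = 1")
      case True
      then show ?thesis using pos1 that by (simp add: s_def)
    next
      case False
      then have "s 1 < s i" using that by (intro mono) auto
      moreover have "0 < s 1" using pos1 that by (simp add: s_def)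
      ultimately show ?thesis by simp
    qed
    have abs_r: "\<bar>r i\<bar> = s i" if "1 \<le> i" "i \<le> n" for i
    proof -
      have "\<bar>r i\<bar> = \<bar>s i\<bar>" by (simp add: s_def abs_mult)
      also have "\<dots> = s i" using pos[OF that] by simp
      finally show ?thesis .
    qed
    have abs_mono: "\<bar>r i\<bar> < \<bar>r k\<bar>" if "1 \<le> i" "i < k" "k \<le> n" for i k
      using mono[OF that] abs_r[of i] abs_r[of k] that by simp
    have sgn: "(-1) ^ n * r j * (\<Prod>k\<in>{1..n} - {j}. (r j)\<^sup>2 - (r k)\<^sup>2) < 0 \<longleftrightarrow>
        0 < (-1) ^ (j + 1) * r j" if "j \<in> {1..n}" for j
      using abs_mono that by (rule sign_prod_diff_squares)
    show ?S
    proof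
      fix a assume "a \<in> R"
      then obtain j where j: "j \<in> {1..n}" "a = r j"
        using bij by (auto simp: bij_betw_def)
      have "0 < (-1) ^ (j + 1) * r j"
        using pos[of j] j by (simp add: s_def)
      then show "(-1) ^ n * a * (\<Prod>b\<in>R - {a}. a\<^sup>2 - b\<^sup>2) < 0"
        unfolding j(2) reindex[OF bij j(1)] sgn[OF j(1)] .
    qed
  next
    assume S: ?S
    have inj: "inj_on abs R"
    proof (rule inj_onI, rule ccontr)
      fix a b assume ab: "a \<in> R" "b \<in> R" "\<bar>a\<bar> = \<bar>b\<bar>" "a \<noteq> b"
      then have "a\<^sup>2 - b\<^sup>2 = 0" by (metis power2_abs diff_self)
      then have "(\<Prod>b\<in>R - {a}. a\<^sup>2 - b\<^sup>2) = 0"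
        using ab fin by (intro prod_zero) auto
      then show False using bspec[OF S ab(1)] by simp
    qed
    define xs where "xs = sorted_list_of_set (abs ` R)"
    \<comment> \<open>The list is indexed from 0, the numbering from 1.\<close>
    define h where "h = (\<lambda>i. xs ! (i - 1))"
    have len: "length xs = n"
      by (simp add: xs_def n_def card_image[OF inj])
    have sorted: "sorted_wrt (<) xs"
      by (simp add: xs_def)
    have hmono: "h i < h k" if "1 \<le> i" "i < k" "k \<le> n" for i k
      unfolding h_def using that len by (intro sorted_wrt_nth_less[OF sorted]) auto
    have "bij_betw (\<lambda>i. i - 1) {1..n} {..<n}"
      by (rule bij_betwI[of _ _ _ Suc]) auto
    moreover have "bij_betw ((!) xs) {..<n} (abs ` R)"
      by (rule bij_betw_nth) (simp_all add: xs_def fin flip: len)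
    ultimately have "bij_betw ((!) xs \<circ> (\<lambda>i. i - 1)) {1..n} (abs ` R)"
      by (rule bij_betw_trans)
    then have hbij: "bij_betw h {1..n} (abs ` R)"
      by (simp add: h_def o_def)
    define r where "r = inv_into R abs \<circ> h"
    have bij: "bij_betw r {1..n} R"
      unfolding r_def using hbij inj
      by (intro bij_betw_trans[OF hbij] bij_betw_inv_into) (simp add: bij_betw_def)
    have abs_r: "\<bar>r i\<bar> = h i" if "1 \<le> i" "i \<le> n" for i
      using bij_betwE[OF hbij] that by (auto simp: r_def f_inv_into_f)
    have abs_mono: "\<bar>r i\<bar> < \<bar>r k\<bar>" if "1 \<le> i" "i < k" "k \<le> n" for i k
      using hmono[OF that] abs_r[of i] abs_r[of k] that by simp
    have sgn: "(-1) ^ n * r j * (\<Prod>k\<in>{1..n} - {j}. (r j)\<^sup>2 - (r k)\<^sup>2) < 0 \<longleftrightarrow>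
        0 < (-1) ^ (j + 1) * r j" if "j \<in> {1..n}" for j
      using abs_mono that by (rule sign_prod_diff_squares)
    have pos: "0 < (-1) ^ (j + 1) * r j" if "1 \<le> j" "j \<le> n" for j
    proof -
      have j: "j \<in> {1..n}" using that by simp
      have rj: "r j \<in> R" using bij_betwE[OF bij] j by blast
      show ?thesis
        using bspec[OF S rj] unfolding reindex[OF bij j] sgn[OF j] .
    qed
    have alt: "(-1) ^ (j + 1) * r j = h j" if "1 \<le> j" "j \<le> n" for j
    proof -
      have "(-1) ^ (j + 1) * r j = \<bar>(-1) ^ (j + 1) * r j\<bar>"
        using pos[OF that] by (rule abs_of_pos[symmetric])
      also have "\<dots> = h j"
        using abs_r[OF that] by (simp add: abs_mult)
      finally show ?thesis .
    qed
    have "(-1) ^ (i + 1) * r i < (-1) ^ (i + 2) * r (i + 1)" if "1 \<le> i" "i < n" for i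
      using hmono[of i "i + 1"] alt[of i] alt[of "i + 1"] that by simp
    moreover have "0 < r 1" if "1 \<le> n"
      using pos[of 1] that by simp
    ultimately show ?L using bij by blast
  qed
qed

lemma residues_imp_rsquarefree:
  assumes real: "\<forall>z. poly (complex_poly p) z = 0 \<longrightarrow> z \<in> \<real>"
    and res: "\<forall>x. poly p x = 0 \<longrightarrow> poly (pderiv p) x * poly p (- x) < 0"
  shows "rsquarefree (complex_poly p)"
  unfolding rsquarefree_roots
proof (intro allI notI, elim conjE)
  fix z assume z: "poly (complex_poly p) z = 0" "poly (pderiv (complex_poly p)) z = 0"
  then obtain x where "z = of_real x" using real by (auto elim: Reals_cases)
  then show False
    using z res[rule_format, of x] by (simp add: pderiv_complex_poly poly_complex_poly_of_real)
qed

text \<open>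
The condition that links the two sides of the theorem. Its second part says that at every zero
the function \<open>p(-z) / p(z)\<close> has a simple pole with negative residue \<open>p(-x) / p'(x)\<close>; by
\<open>pderiv_times_reflection_at_zero\<close> this residue has the sign of the quantity that
\<open>alternating_numbering_iff\<close> is about.
\<close>

lemma self_interlacing_I_iff_residues:
  "self_interlacing_I p \<longleftrightarrow>
     (\<forall>z. poly (complex_poly p) z = 0 \<longrightarrow> z \<in> \<real>) \<and>
     (\<forall>x. poly p x = 0 \<longrightarrow> poly (pderiv p) x * poly p (- x) < 0)"
proof (cases "(\<forall>z. poly (complex_poly p) z = 0 \<longrightarrow> z \<in> \<real>) \<and> rsquarefree (complex_poly p)")
  case True
  then have real: "\<forall>z. poly (complex_poly p) z = 0 \<longrightarrow> z \<in> \<real>"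
    and sf: "rsquarefree (complex_poly p)"
    by auto
  define R c where "R = {x. poly p x = 0}" and "c = lead_coeff p"
  note fact = simple_real_zeroes_factorization[OF real sf, folded R_def, folded c_def]
  have p0: "p \<noteq> 0" using sf by (auto simp: rsquarefree_def)
  then have c0: "c \<noteq> 0" by (simp add: c_def)
  have fin: "finite R" unfolding R_def by (rule poly_roots_finite[OF p0])
  have "self_interlacing_I p \<longleftrightarrow>
      (\<forall>a\<in>R. (-1) ^ card R * a * (\<Prod>b\<in>R - {a}. a\<^sup>2 - b\<^sup>2) < 0)"
    unfolding self_interlacing_I_def alternating_numbering_iff[OF fin, symmetric]
    using real sf p0 fact(2) by (auto simp: rsquarefree_root_order R_def map_poly_eq_0_iff)
  also have "\<dots> \<longleftrightarrow> (\<forall>a\<in>R. poly (pderiv p) a * poly p (- a) < 0)"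
  proof (rule ball_cong)
    fix a assume a: "a \<in> R"
    have "poly (pderiv p) a * poly p (- a) =
        2 * c\<^sup>2 * ((-1) ^ card R * a * (\<Prod>b\<in>R - {a}. a\<^sup>2 - b\<^sup>2))"
      by (rule pderiv_times_reflection_at_zero[OF fin a, of c, folded fact(1)])
    then show "(-1) ^ card R * a * (\<Prod>b\<in>R - {a}. a\<^sup>2 - b\<^sup>2) < 0 \<longleftrightarrow>
        poly (pderiv p) a * poly p (- a) < 0"
      using c0 by (simp only: mult_less_0_iff[of "2 * c\<^sup>2"]) simp
  qed simp
  finally show ?thesis using real by (auto simp: R_def)
next
  case False
  \<comment> \<open>The zero polynomial vanishes at the nonreal point \<open>\<i>\<close>.\<close>
  have "complex_poly p \<noteq> 0" if "\<forall>z. poly (complex_poly p) z = 0 \<longrightarrow> z \<in> \<real>"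
    using that[rule_format, of \<i>] by (auto simp: complex_is_Real_iff)
  then have "rsquarefree (complex_poly p)" if "self_interlacing_I p"
    using that unfolding self_interlacing_I_def rsquarefree_def order_root by blast
  moreover have "rsquarefree (complex_poly p)"
    if real: "\<forall>z. poly (complex_poly p) z = 0 \<longrightarrow> z \<in> \<real>"
      and res: "\<forall>x. poly p x = 0 \<longrightarrow> poly (pderiv p) x * poly p (- x) < 0"
    using real res by (rule residues_imp_rsquarefree)
  ultimately show ?thesis
    using False unfolding self_interlacing_I_def by blast
qed

section \<open>Stability of the rotated polynomial\<close>

text \<open>
The hypothesis \<open>rot\<close> is \<open>2 q(\<i>z) = (1 - \<i>) p(z) + (1 + \<i>) p(-z)\<close>, with \<open>w = \<i>z\<close> as the variable; as an
identity of polynomials it can also be differentiated. At a real zero \<open>x\<close> of \<open>p\<close> the phase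
inequality for \<open>Q\<close> at \<open>\<i>x\<close> becomes \<open>- p'(x) p(-x) / 2 > 0\<close>.
\<close>

lemma stable_rotation_imp_residues:
  assumes rot: "smult 2 (complex_poly q) = smult (1 - \<i>) (pcompose (complex_poly p) [:0, -\<i>:])
                                        + smult (1 + \<i>) (pcompose (complex_poly p) [:0, \<i>:])"
    and stable: "hurwitz_stable q"
  shows "\<forall>z. poly (complex_poly p) z = 0 \<longrightarrow> z \<in> \<real>"
    and "\<forall>x. poly p x = 0 \<longrightarrow> poly (pderiv p) x * poly p (- x) < 0"
proof -
  define P Q where "P = complex_poly p" and "Q = complex_poly q"
  have st: "Re z < 0" if "poly Q z = 0" for z
    using stable that by (simp add: hurwitz_stable_def Q_def)
  have rot': "smult 2 Q = smult (1 - \<i>) (pcompose P [:0, -\<i>:]) + smult (1 + \<i>) (pcompose P [:0, \<i>:])"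
    using rot by (simp add: P_def Q_def)
  have ev: "2 * poly Q w = (1 - \<i>) * poly P (- (\<i> * w)) + (1 + \<i>) * poly P (\<i> * w)" for w
    using arg_cong[OF rot', of "\<lambda>f. poly f w"] by (simp add: poly_pcompose mult.commute)
  have dev: "2 * poly (pderiv Q) w =
      (- 1 - \<i>) * poly (pderiv P) (- (\<i> * w)) + (\<i> - 1) * poly (pderiv P) (\<i> * w)" for w
    using arg_cong[OF rot', of "\<lambda>f. poly (pderiv f) w"]
    by (simp add: poly_pcompose pderiv_smult pderiv_add pderiv_pcompose pderiv_pCons algebra_simps)
  have at_zero: "2 * poly Q (\<i> * z) = (1 + \<i>) * poly P (- z)"
    "2 * poly Q (- (\<i> * z)) = (1 - \<i>) * poly P (- z)" if "poly P z = 0" for z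
    using ev[of "\<i> * z"] ev[of "- (\<i> * z)"] that by (simp_all add: mult.assoc[symmetric])
  \<comment> \<open>The two inequalities need a nonconstant \<open>Q\<close>. If \<open>Q\<close> were constant, the two values above would
      coincide, so that \<open>Q\<close> would vanish identically.\<close>
  have deg: "degree Q > 0" if "poly P z = 0" for z
  proof (rule ccontr)
    assume "\<not> degree Q > 0"
    then obtain k where "Q = [:k:]" by (auto elim: degree_eq_zeroE)
    then have "2 * k = (1 + \<i>) * poly P (- z)" "2 * k = (1 - \<i>) * poly P (- z)"
      using at_zero[OF that] by simp_all
    then have "(2 * \<i>) * poly P (- z) = 0" by (simp add: algebra_simps)
    then have "k = 0" using \<open>2 * k = (1 + \<i>) * poly P (- z)\<close> by simp
    then show False using st[of 0] \<open>Q = [:k:]\<close> by simp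
  qed
  show "\<forall>z. poly (complex_poly p) z = 0 \<longrightarrow> z \<in> \<real>"
  proof (intro allI impI, rule ccontr)
    fix z assume "poly (complex_poly p) z = 0" and "z \<notin> \<real>"
    then have z: "poly P z = 0" and im: "Im z \<noteq> 0"
      by (simp_all add: P_def complex_is_Real_iff)
    have "norm (2 * poly Q (\<i> * z)) = norm (2 * poly Q (- (\<i> * z)))"
      unfolding at_zero[OF z] norm_mult by (simp add: cmod_def)
    then have eq: "norm (poly Q (\<i> * z)) = norm (poly Q (- (\<i> * z)))"
      by (simp add: norm_mult)
    \<comment> \<open>\<open>Q\<close> has real coefficients, so reflection in the imaginary axis and in the origin give values of
        equal modulus.\<close>
    have less: "norm (poly Q (- w)) < norm (poly Q w)" if "Re w > 0" for w
    proof -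
      have "poly Q (- cnj w) = cnj (poly Q (- w))"
        by (subst poly_cnj_real) (simp_all add: Q_def coeff_map_poly)
      then show ?thesis
        using stable_reflection_less[OF st that deg[OF z]] by simp
    qed
    show False
      using less[of "\<i> * z"] less[of "- (\<i> * z)"] eq im by (cases "Im z > 0") auto
  qed
  show "\<forall>x. poly p x = 0 \<longrightarrow> poly (pderiv p) x * poly p (- x) < 0"
  proof (intro allI impI)
    fix x assume x: "poly p x = 0"
    define d d' m where "d = poly (pderiv p) x" and "d' = poly (pderiv p) (- x)" and "m = poly p (- x)"
    define w where "w = \<i> * complex_of_real x"
    have Px: "poly P (of_real x) = 0" using x by (simp add: P_def poly_complex_poly_of_real)
    have m: "poly P (- of_real x) = of_real m"
      using poly_complex_poly_of_real[of p "- x"] by (simp add: P_def m_def)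
    have d': "poly (pderiv P) (- of_real x) = of_real d'"
      using poly_complex_poly_of_real[of "pderiv p" "- x"] by (simp add: P_def d'_def pderiv_complex_poly)
    have d: "poly (pderiv P) (of_real x) = of_real d"
      by (simp add: P_def d_def pderiv_complex_poly poly_complex_poly_of_real)
    have Qw: "2 * poly Q w = (1 + \<i>) * of_real m"
      using at_zero(1)[OF Px] m by (simp add: w_def)
    have dQw: "2 * poly (pderiv Q) w = (- 1 - \<i>) * of_real d + (\<i> - 1) * of_real d'"
      using dev[of w] d d' by (simp add: w_def mult.assoc[symmetric])
    \<comment> \<open>The term with \<open>p'(-x)\<close> is purely imaginary and drops out.\<close>
    have "4 * Re (poly (pderiv Q) w * cnj (poly Q w)) = Re ((2 * poly (pderiv Q) w) * cnj (2 * poly Q w))"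
      by simp
    also have "\<dots> = - 2 * (d * m)"
      unfolding Qw dQw by (simp add: algebra_simps)
    finally have "4 * Re (poly (pderiv Q) w * cnj (poly Q w)) = - 2 * (d * m)" .
    moreover have "Re (poly (pderiv Q) w * cnj (poly Q w)) > 0"
      by (rule stable_phase_increasing[OF st _ deg[OF Px]]) (simp_all add: w_def)
    ultimately show "poly (pderiv p) x * poly p (- x) < 0"
      by (simp add: d_def m_def)
  qed
qed

text \<open>
A zero \<open>w = \<i>z\<close> of \<open>q\<close> satisfies \<open>p(-z) = \<i> p(z)\<close>. The imaginary part of the partial fraction
expansion of \<open>p(-z) / p(z)\<close> is \<open>Im z\<close> times a nonnegative sum, and it must equal 1.
\<close>

lemma residues_imp_stable_rotation:
  assumes rot: "smult 2 (complex_poly q) = smult (1 - \<i>) (pcompose (complex_poly p) [:0, -\<i>:])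
                                        + smult (1 + \<i>) (pcompose (complex_poly p) [:0, \<i>:])"
    and real: "\<forall>z. poly (complex_poly p) z = 0 \<longrightarrow> z \<in> \<real>"
    and res: "\<forall>x. poly p x = 0 \<longrightarrow> poly (pderiv p) x * poly p (- x) < 0"
  shows "hurwitz_stable q"
  unfolding hurwitz_stable_def
proof (intro allI impI)
  fix w assume w: "poly (complex_poly q) w = 0"
  define P z where "P = complex_poly p" and "z = - (\<i> * w)"
  define R where "R = {x. poly p x = 0}"
  define g where "g = pcompose p [:0, -1:]"
  define t where "t = (\<lambda>x. poly p (- x) / poly (pderiv p) x)"
  have t: "t x < 0" if "x \<in> R" for x
    using res that by (auto simp: t_def R_def mult_less_0_iff divide_less_0_iff)
  have sf: "rsquarefree P"
    unfolding P_def using real res by (rule residues_imp_rsquarefree)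
  have zs: "{z. poly P z = 0} = complex_of_real ` R"
    unfolding P_def R_def using real by (rule real_zeroes_image)
  have G: "poly (complex_poly g) u = poly P (- u)" for u
    by (simp add: g_def poly_complex_poly_pcompose P_def map_poly_pCons)
  have "(1 - \<i>) * poly P z + (1 + \<i>) * poly P (- z) = 0"
    using arg_cong[OF rot, of "\<lambda>f. poly f w"] w by (simp add: poly_pcompose mult.commute P_def z_def)
  \<comment> \<open>\<open>(1 - \<i>)\<^sup>2 = - 2\<i>\<close> and \<open>(1 - \<i>) (1 + \<i>) = 2\<close>.\<close>
  then have "(1 - \<i>) * ((1 - \<i>) * poly P z + (1 + \<i>) * poly P (- z)) = 0"
    by simp
  then have refl: "poly P (- z) = \<i> * poly P z"
    by (simp add: algebra_simps)
  have Pz: "poly P z \<noteq> 0"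
  proof
    assume Pz: "poly P z = 0"
    then obtain x where x: "z = of_real x" using real by (auto simp: P_def elim: Reals_cases)
    have "poly P (of_real (- x)) = 0" using refl Pz x by simp
    then have "poly p (- x) = 0" by (simp only: P_def poly_complex_poly_of_real of_real_eq_0_iff)
    moreover have "poly p x = 0" using Pz x by (simp add: P_def poly_complex_poly_of_real)
    ultimately show False using res[rule_format, of x] by simp
  qed
  define k where "k = coeff g (degree p) / lead_coeff p"
  \<comment> \<open>The constant term of the expansion is real because \<open>g(x) = p(-x)\<close> is a real polynomial.\<close>
  have "\<i> = poly (complex_poly g) z / poly P z"
    using Pz by (simp add: G refl)
  also have "\<dots> = of_real k + (\<Sum>a\<in>complex_of_real ` R. poly P (- a) / poly (pderiv P) a / (z - a))"
    by (subst partial_fractions_simple_zeroes[OF sf _ Pz])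
       (simp_all add: P_def degree_map_poly g_def degree_pcompose coeff_map_poly k_def G[unfolded P_def g_def] zs[unfolded P_def])
  also have "\<dots> = of_real k + (\<Sum>x\<in>R. of_real (t x) / (z - of_real x))"
  proof -
    have "poly P (- of_real x) / poly (pderiv P) (of_real x) = of_real (t x)" for x
      using poly_complex_poly_of_real[of p "- x"]
      by (simp add: P_def t_def pderiv_complex_poly poly_complex_poly_of_real)
    then show ?thesis by (simp add: sum.reindex inj_on_def del: divide_divide_eq_left)
  qed
  finally have "Im \<i> = Im (of_real k + (\<Sum>x\<in>R. of_real (t x) / (z - of_real x)))"
    by (rule arg_cong)
  also have "\<dots> = (\<Sum>x\<in>R. Im z * (- t x / (norm (z - of_real x))\<^sup>2))"
    by (simp add: Im_divide cmod_power2 Im_sum mult.commute)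
  also have "\<dots> = Im z * (\<Sum>x\<in>R. - t x / (norm (z - of_real x))\<^sup>2)"
    by (simp only: sum_distrib_left)
  finally have one: "Im z * (\<Sum>x\<in>R. - t x / (norm (z - of_real x))\<^sup>2) = 1" by simp
  have "(\<Sum>x\<in>R. - t x / (norm (z - of_real x))\<^sup>2) \<ge> 0"
    using t by (intro sum_nonneg divide_nonneg_nonneg) (auto intro: less_imp_le)
  then have "Im z > 0"
    using one mult_nonpos_nonneg[of "Im z" "\<Sum>x\<in>R. - t x / (norm (z - of_real x))\<^sup>2"]
    by linarith
  then show "Re w < 0" by (simp add: z_def)
qed

theorem theorem4p8:
  fixes p p0 p1 q :: "real poly"
  assumes "p = pcompose p0 [:0, 0, 1:] + [:0, 1:] * pcompose p1 [:0, 0, 1:]"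
    and "q = pcompose p0 [:0, 0, -1:] - [:0, 1:] * pcompose p1 [:0, 0, -1:]"
  shows "self_interlacing_I p \<longleftrightarrow> hurwitz_stable q"
proof -
  define P0 P1 where "P0 = complex_poly p0" and "P1 = complex_poly p1"
  have P: "poly (complex_poly p) z = poly P0 (z\<^sup>2) + z * poly P1 (z\<^sup>2)" for z
    by (simp add: assms(1) complex_poly_add map_poly_pCons poly_complex_poly_pcompose P0_def P1_def power2_eq_square)
  have Q: "poly (complex_poly q) z = poly P0 (- z\<^sup>2) - z * poly P1 (- z\<^sup>2)" for z
    by (simp add: assms(2) complex_poly_diff map_poly_pCons poly_complex_poly_pcompose P0_def P1_def power2_eq_square)
  have rot: "smult 2 (complex_poly q) = smult (1 - \<i>) (pcompose (complex_poly p) [:0, -\<i>:])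
                                   + smult (1 + \<i>) (pcompose (complex_poly p) [:0, \<i>:])"
    by (rule poly_ext) (simp add: poly_pcompose P Q power_mult_distrib algebra_simps)
  show ?thesis
    unfolding self_interlacing_I_iff_residues
    using stable_rotation_imp_residues[OF rot] residues_imp_stable_rotation[OF rot] by blast
qed

end
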